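(* For all integers $g \ge 2$ one has $$\mu_g \ \le \ \frac{\sqrt{2g-1}}{g}.$$ In particular $\mu_2 \le \frac{\sqrt 3}{2} \approx 0.8660$.
   Context: For $g\ge 2$ let $\Gamma_g$ be the fundamental group of the closed orientable surface of genus $g$, given by the presentation $\Gamma_g=\langle a_1,b_1,\dots,a_g,b_g \mid \prod_{j=1}^g a_jb_ja_j^{-1}b_j^{-1}=1\rangle$, and let $S_g=\{a_1,a_1^{-1},b_1,b_1^{-1},\dots,a_g,a_g^{-1},b_g,b_g^{-1}\}$, a symmetric generating set with $4g$ elements. The Cayley graph $X_g=\mathrm{Cay}(\Gamma_g,S_g)$ has vertex set $\Gamma_g$, with $\{x,y\}$ an edge if and only if $x^{-1}y\in S_g$; it is $4g$-regular. The Markov operator $M$ of a connected $k$-regular graph with vertex set $X^0$ is $(Mf)(x)=\frac1k\sum_{y\sim x}f(y)$ (sum over neighbours $y$ of $x$), a bounded self-adjoint operator on $\ell^2(X^0)$; the spectral radius of the graph is the operator norm of $M$ on $\ell^2(X^0)$. The number $\mu_g$ is the spectral radius of $X_g$. *)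

theory Defs
  imports "HOL-Analysis.Infinite_Sum" "HOL-Algebra.Group"
begin

section \<open>Groups given by presentations\<close>

text \<open>A letter \<open>(a, True)\<close> stands for the generator \<open>a\<close> and \<open>(a, False)\<close> for its formal
  inverse. The presented group consists of the words in these letters modulo insertion and deletion
  of trivial relators and of the given relators.\<close>

type_synonym 'a word = "('a \<times> bool) list"

definition words :: "'a set \<Rightarrow> 'a word set" where
  "words A = lists (A \<times> UNIV)"

inductive pres_eq :: "'a set \<Rightarrow> 'a word set \<Rightarrow> 'a word \<Rightarrow> 'a word \<Rightarrow> bool"
  for A R where
  refl: "u \<in> words A \<Longrightarrow> pres_eq A R u u"
| sym: "pres_eq A R u v \<Longrightarrow> pres_eq A R v u"
| trans: "pres_eq A R u v \<Longrightarrow> pres_eq A R v w \<Longrightarrow> pres_eq A R u w"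
| cancel: "u \<in> words A \<Longrightarrow> v \<in> words A \<Longrightarrow> a \<in> A \<Longrightarrow>
    pres_eq A R (u @ [(a, e), (a, \<not> e)] @ v) (u @ v)"
| relator: "u \<in> words A \<Longrightarrow> v \<in> words A \<Longrightarrow> r \<in> R \<Longrightarrow> r \<in> words A \<Longrightarrow>
    pres_eq A R (u @ r @ v) (u @ v)"

definition pres_rel :: "'a set \<Rightarrow> 'a word set \<Rightarrow> 'a word rel" where
  "pres_rel A R = {(u, v). pres_eq A R u v}"

definition presented_group :: "'a set \<Rightarrow> 'a word set \<Rightarrow> 'a word set monoid" where
  "presented_group A R =
    \<lparr>carrier = words A // pres_rel A R,
     mult = (\<lambda>X Y. \<Union>u\<in>X. \<Union>v\<in>Y. pres_rel A R `` {u @ v}),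
     one = pres_rel A R `` {[]}\<rparr>"

definition pres_gen :: "'a set \<Rightarrow> 'a word set \<Rightarrow> 'a \<Rightarrow> 'a word set" where
  "pres_gen A R a = pres_rel A R `` {[(a, True)]}"

lemma words_simps [simp]:
  "[] \<in> words A"
  "x # u \<in> words A \<longleftrightarrow> fst x \<in> A \<and> u \<in> words A"
  "u @ v \<in> words A \<longleftrightarrow> u \<in> words A \<and> v \<in> words A"
  by (auto simp: words_def mem_Times_iff)

lemma pres_eq_words:
  assumes "pres_eq A R u v"
  shows "u \<in> words A \<and> v \<in> words A"
  using assms by induction auto

lemma pres_eq_append_left:
  assumes "pres_eq A R u v" "w \<in> words A"
  shows "pres_eq A R (w @ u) (w @ v)"
  using assms
proof induction
  case (cancel u v a e)
  then show ?case using pres_eq.cancel[of "w @ u" A v a R e] by simp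
next
  case (relator u v r)
  then show ?case using pres_eq.relator[of "w @ u" A v r R] by simp
qed (auto intro: pres_eq.refl pres_eq.sym pres_eq.trans)

lemma pres_eq_append_right:
  assumes "pres_eq A R u v" "w \<in> words A"
  shows "pres_eq A R (u @ w) (v @ w)"
  using assms
proof induction
  case (cancel u v a e)
  then show ?case using pres_eq.cancel[of u A "v @ w" a R e] by simp
next
  case (relator u v r)
  then show ?case using pres_eq.relator[of u A "v @ w" r R] by simp
qed (auto intro: pres_eq.refl pres_eq.sym pres_eq.trans)

lemma pres_eq_append:
  assumes "pres_eq A R u u'" "pres_eq A R v v'"
  shows "pres_eq A R (u @ v) (u' @ v')"
  using assms pres_eq_append_left pres_eq_append_right pres_eq_words pres_eq.trans by metis

lemma equiv_pres_rel: "equiv (words A) (pres_rel A R)"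
proof (rule equivI)
  show "pres_rel A R \<subseteq> words A \<times> words A"
    using pres_eq_words by (auto simp: pres_rel_def)
  show "refl_on (words A) (pres_rel A R)"
    using pres_eq.refl by (auto simp: refl_on_def pres_rel_def)
  show "sym (pres_rel A R)"
    using pres_eq.sym by (auto simp: sym_def pres_rel_def)
  show "trans (pres_rel A R)"
    using pres_eq.trans by (auto simp: trans_def pres_rel_def)
qed

lemma presented_group_mult:
  assumes "u \<in> words A" "v \<in> words A"
  shows "pres_rel A R `` {u} \<otimes>\<^bsub>presented_group A R\<^esub> pres_rel A R `` {v} = pres_rel A R `` {u @ v}"
proof -
  have "congruent2 (pres_rel A R) (pres_rel A R) (\<lambda>u v. pres_rel A R `` {u @ v})"
    by (auto simp: congruent2_def intro!: equiv_class_eq[OF equiv_pres_rel])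
       (auto simp: pres_rel_def intro: pres_eq_append)
  then show ?thesis
    using UN_equiv_class2[OF equiv_pres_rel equiv_pres_rel _ assms]
    by (simp add: presented_group_def)
qed

lemma presented_group_cases:
  assumes "X \<in> carrier (presented_group A R)"
  obtains u where "u \<in> words A" "X = pres_rel A R `` {u}"
  using assms by (auto simp: presented_group_def elim: quotientE)

lemma presented_group_carrierI [intro]:
  "u \<in> words A \<Longrightarrow> pres_rel A R `` {u} \<in> carrier (presented_group A R)"
  by (simp add: presented_group_def quotientI)

lemma inverse_word:
  "u \<in> words A \<Longrightarrow> \<exists>v\<in>words A. pres_eq A R (v @ u) []"
proof (induction u)
  case Nil
  then show ?case by (auto intro!: bexI[of _ "[]"] pres_eq.refl)
next
  case (Cons x u)
  then obtain v where v: "v \<in> words A" "pres_eq A R (v @ u) []" by auto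
  have "pres_eq A R (v @ [(fst x, \<not> snd x), (fst x, \<not> \<not> snd x)] @ u) (v @ u)"
    using Cons.prems v by (intro pres_eq.cancel) auto
  then have "pres_eq A R ((v @ [(fst x, \<not> snd x)]) @ x # u) []"
    using v(2) by (auto intro: pres_eq.trans)
  then show ?case using v(1) Cons.prems by (intro bexI[of _ "v @ [(fst x, \<not> snd x)]"]) auto
qed

theorem group_presented_group: "group (presented_group A R)"
proof (rule groupI)
  have one: "\<one>\<^bsub>presented_group A R\<^esub> = pres_rel A R `` {[]}"
    by (simp add: presented_group_def)
  show "\<one>\<^bsub>presented_group A R\<^esub> \<in> carrier (presented_group A R)"
    by (auto simp: one)
  fix X assume "X \<in> carrier (presented_group A R)"
  then obtain u where u: "u \<in> words A" "X = pres_rel A R `` {u}"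
    by (rule presented_group_cases)
  then show "\<one>\<^bsub>presented_group A R\<^esub> \<otimes>\<^bsub>presented_group A R\<^esub> X = X"
    by (simp add: one presented_group_mult)
  obtain v where v: "v \<in> words A" "pres_eq A R (v @ u) []"
    using inverse_word[OF u(1)] by blast
  then have "pres_rel A R `` {v @ u} = pres_rel A R `` {[]}"
    by (intro equiv_class_eq[OF equiv_pres_rel]) (simp add: pres_rel_def)
  then show "\<exists>Y\<in>carrier (presented_group A R).
      Y \<otimes>\<^bsub>presented_group A R\<^esub> X = \<one>\<^bsub>presented_group A R\<^esub>"
    using u v by (intro bexI[of _ "pres_rel A R `` {v}"]) (auto simp: one presented_group_mult)
  fix Y assume "Y \<in> carrier (presented_group A R)"
  then obtain v where v: "v \<in> words A" "Y = pres_rel A R `` {v}"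
    by (rule presented_group_cases)
  show "X \<otimes>\<^bsub>presented_group A R\<^esub> Y \<in> carrier (presented_group A R)"
    using u v by (auto simp: presented_group_mult)
  fix Z assume "Z \<in> carrier (presented_group A R)"
  then obtain w where w: "w \<in> words A" "Z = pres_rel A R `` {w}"
    by (rule presented_group_cases)
  show "X \<otimes>\<^bsub>presented_group A R\<^esub> Y \<otimes>\<^bsub>presented_group A R\<^esub> Z =
      X \<otimes>\<^bsub>presented_group A R\<^esub> (Y \<otimes>\<^bsub>presented_group A R\<^esub> Z)"
    using u v w by (simp add: presented_group_mult)
qed

section \<open>Markov operators and spectral radii of regular graphs\<close>

definition neighbours :: "'v set set \<Rightarrow> 'v \<Rightarrow> 'v set" where
  "neighbours E x = {y. {x, y} \<in> E}"

text \<open>For a \<open>k\<close>-regular graph the cardinality in the denominator is \<open>k\<close> at every vertex.\<close>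

definition markov_operator :: "'v set set \<Rightarrow> ('v \<Rightarrow> complex) \<Rightarrow> 'v \<Rightarrow> complex" where
  "markov_operator E f x =
    (\<Sum>y\<in>neighbours E x. f y) / of_nat (card (neighbours E x))"

definition ell2 :: "'v set \<Rightarrow> ('v \<Rightarrow> complex) set" where
  "ell2 V = {f. (\<forall>x. x \<notin> V \<longrightarrow> f x = 0) \<and> (\<lambda>x. (cmod (f x))\<^sup>2) summable_on V}"

definition ell2_norm :: "'v set \<Rightarrow> ('v \<Rightarrow> complex) \<Rightarrow> real" where
  "ell2_norm V f = sqrt (\<Sum>\<^sub>\<infinity>x\<in>V. (cmod (f x))\<^sup>2)"

text \<open>This is the usual operator norm when \<open>T\<close> is a bounded operator on \<open>ell2 V\<close>; the
  supremum is unspecified when \<open>T\<close> is unbounded.\<close>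

definition ell2_opnorm :: "'v set \<Rightarrow> (('v \<Rightarrow> complex) \<Rightarrow> 'v \<Rightarrow> complex) \<Rightarrow> real" where
  "ell2_opnorm V T = (SUP f\<in>{f \<in> ell2 V. ell2_norm V f \<le> 1}. ell2_norm V (T f))"

definition spectral_radius :: "'v set \<Rightarrow> 'v set set \<Rightarrow> real" where
  "spectral_radius V E = ell2_opnorm V (markov_operator E)"

definition cayley_edges :: "('b, 'm) monoid_scheme \<Rightarrow> 'b set \<Rightarrow> 'b set set" where
  "cayley_edges G S =
    {{x, y} | x y. x \<in> carrier G \<and> y \<in> carrier G \<and> inv\<^bsub>G\<^esub> x \<otimes>\<^bsub>G\<^esub> y \<in> S}"

section \<open>Surface groups\<close>

datatype surface_gen = Ga nat | Gb nat

definition surface_gens :: "nat \<Rightarrow> surface_gen set" where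
  "surface_gens g = Ga ` {1..g} \<union> Gb ` {1..g}"

definition surface_relator :: "nat \<Rightarrow> surface_gen word" where
  "surface_relator g =
    concat (map (\<lambda>j. [(Ga j, True), (Gb j, True), (Ga j, False), (Gb j, False)]) [1..<Suc g])"

definition surface_group :: "nat \<Rightarrow> surface_gen word set monoid" where
  "surface_group g = presented_group (surface_gens g) {surface_relator g}"

definition surface_genset :: "nat \<Rightarrow> surface_gen word set set" where
  "surface_genset g =
    (let s = pres_gen (surface_gens g) {surface_relator g}
     in \<Union>x\<in>surface_gens g. {s x, inv\<^bsub>surface_group g\<^esub> (s x)})"

definition surface_mu :: "nat \<Rightarrow> real" where
  "surface_mu g = spectral_radius (carrier (surface_group g))
     (cayley_edges (surface_group g) (surface_genset g))"

end

theory Submission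
  imports Defs "HOL-Analysis.Convex"
begin

text \<open>The defining relation reads \<open>W a\<^sub>g b\<^sub>g a\<^sub>g\<inverse> b\<^sub>g\<inverse> = 1\<close>, where \<open>W\<close> does not involve
  \<open>a\<^sub>g, b\<^sub>g\<close>. Hence \<open>\<Gamma>\<^sub>g\<close> acts on a free group from the right: every generator except \<open>b\<^sub>g\<close> acts by
  multiplication, and \<open>b\<^sub>g\<close> acts by the transvection taking \<open>a\<^sub>g\<close> to \<open>W\<inverse> a\<^sub>g\<close>. Following the
  trivial element of the free group under this action, one orients each Cayley edge labelled
  \<open>\<noteq> b\<^sub>g\<close> along the change in length of the reduced word, and each \<open>b\<^sub>g\<close>-edge along its
  label. At each vertex at most two of the \<open>4 g\<close> edges point in one chosen sense, since a reduced
  word can be shortened by at most one letter. Giving these edges the weight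
  \<open>q = sqrt (2 g - 1)\<close> and the others the weight \<open>1 / q\<close>, the sum of the weights at a vertex is at most
  \<open>2 q + (4 g - 2) / q = 4 q\<close>, and the Schur test gives \<open>\<mu>\<^sub>g \<le> 4 q / (4 g)\<close>.\<close>

section \<open>A weighted Schur test\<close>

lemma weighted_sum_square_le:
  fixes a w :: "'i \<Rightarrow> real"
  assumes "\<And>i. i \<in> I \<Longrightarrow> w i > 0"
  shows "(\<Sum>i\<in>I. a i)\<^sup>2 \<le> (\<Sum>i\<in>I. w i) * (\<Sum>i\<in>I. (a i)\<^sup>2 / w i)"
proof -
  have "(\<Sum>i\<in>I. a i) = (\<Sum>i\<in>I. sqrt (w i) * (a i / sqrt (w i)))"
    using assms[THEN less_imp_neq, THEN not_sym] by (intro sum.cong) auto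
  also have "\<dots>\<^sup>2 \<le> (\<Sum>i\<in>I. (sqrt (w i))\<^sup>2) * (\<Sum>i\<in>I. (a i / sqrt (w i))\<^sup>2)"
    by (rule Cauchy_Schwarz_ineq_sum)
  also have "\<dots> = (\<Sum>i\<in>I. w i) * (\<Sum>i\<in>I. (a i)\<^sup>2 / w i)"
    using assms by (intro arg_cong2[where f = "(*)"] sum.cong)
      (auto simp: power_divide less_imp_le)
  finally show ?thesis .
qed

lemma has_sum_sum:
  fixes h :: "'i \<Rightarrow> 'v \<Rightarrow> real"
  assumes "finite I" "\<And>i. i \<in> I \<Longrightarrow> (h i has_sum s i) V"
  shows "((\<lambda>x. \<Sum>i\<in>I. h i x) has_sum (\<Sum>i\<in>I. s i)) V"
  using assms by (induction I rule: finite_induct) (auto intro: has_sum_add)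

lemma
  fixes h :: "'i \<Rightarrow> 'v \<Rightarrow> real"
  assumes "finite I" "\<And>i. i \<in> I \<Longrightarrow> h i summable_on V"
  shows summable_on_sum: "(\<lambda>x. \<Sum>i\<in>I. h i x) summable_on V"
    and infsum_sum: "(\<Sum>\<^sub>\<infinity>x\<in>V. \<Sum>i\<in>I. h i x) = (\<Sum>i\<in>I. infsum (h i) V)"
  using has_sum_sum[of I h V "\<lambda>i. infsum (h i) V"] assms
  by (auto simp: has_sum_iff)

text \<open>The edge from \<open>x\<close> with label \<open>i\<close> ends at \<open>p i x\<close> and has weight \<open>w x i\<close>; the reverse
  edge has label \<open>\<nu> i\<close> and the reciprocal weight.\<close>

lemma spectral_radius_le_weights:
  fixes V :: "'v set" and I :: "'i set" and w :: "'v \<Rightarrow> 'i \<Rightarrow> real"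
  assumes fin: "finite I"
    and p: "\<And>i x. i \<in> I \<Longrightarrow> x \<in> V \<Longrightarrow> p i x \<in> V"
    and nu: "\<And>i. i \<in> I \<Longrightarrow> \<nu> i \<in> I" "\<And>i. i \<in> I \<Longrightarrow> \<nu> (\<nu> i) = i"
    and rev: "\<And>i x. i \<in> I \<Longrightarrow> x \<in> V \<Longrightarrow> p (\<nu> i) (p i x) = x"
    and nb: "\<And>x. x \<in> V \<Longrightarrow> neighbours E x = (\<lambda>i. p i x) ` I"
    and inj: "\<And>x. x \<in> V \<Longrightarrow> inj_on (\<lambda>i. p i x) I"
    and wpos: "\<And>x i. x \<in> V \<Longrightarrow> i \<in> I \<Longrightarrow> w x i > 0"
    and wrec: "\<And>x i. x \<in> V \<Longrightarrow> i \<in> I \<Longrightarrow> w x i * w (p i x) (\<nu> i) = 1"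
    and wsum: "\<And>x. x \<in> V \<Longrightarrow> (\<Sum>i\<in>I. w x i) \<le> K"
    and K: "K \<ge> 0"
  shows "spectral_radius V E \<le> K / card I"
proof -
  have bound: "ell2_norm V (markov_operator E f) \<le> K / card I"
    if f: "f \<in> ell2 V" "ell2_norm V f \<le> 1" for f
  proof -
    define F where "F x = (cmod (f x))\<^sup>2" for x
    \<comment> \<open>At \<open>p i x\<close> this is the Cauchy-Schwarz term
      \<open>F (p i x) / w x i\<close>, because reverse edges have reciprocal weights. Since
      \<open>p i\<close> permutes \<open>V\<close>, the shift disappears in sums over
      \<open>V\<close>.\<close>
    define h where "h i x = F x * w x (\<nu> i)" for i x
    have F: "F summable_on V" using f by (simp add: ell2_def F_def[abs_def])
    have F0: "F x \<ge> 0" for x by (simp add: F_def)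
    have FK: "(\<lambda>x. K * F x) summable_on V"
      using F by (rule summable_on_cmult_right)
    have hs: "h i summable_on V" if i: "i \<in> I" for i
    proof (rule summable_on_comparison_test[OF FK])
      fix x assume x: "x \<in> V"
      have "w x (\<nu> i) \<le> (\<Sum>i\<in>I. w x i)"
        using wpos[OF x] nu(1)[OF i] fin by (intro member_le_sum) (auto intro: less_imp_le)
      then show "h i x \<le> K * F x"
        using wsum[OF x] F0[of x] mult_right_mono[of "w x (\<nu> i)" K "F x"]
        by (simp add: h_def mult.commute)
      show "0 \<le> h i x"
        using wpos[OF x nu(1)[OF i]] F0[of x] by (simp add: h_def)
    qed
    have bij: "bij_betw (p i) V V" if i: "i \<in> I" for i
      using p[OF i] p[OF nu(1)[OF i]] rev[OF i] rev[OF nu(1)[OF i]] nu(2)[OF i]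
      by (intro bij_betwI[where g = "p (\<nu> i)"]) auto
    have hps: "(\<lambda>x. h i (p i x)) summable_on V" if "i \<in> I" for i
      using hs[OF that] summable_on_reindex_bij_betw[OF bij[OF that]] by blast
    have hpi: "(\<Sum>\<^sub>\<infinity>x\<in>V. h i (p i x)) = (\<Sum>\<^sub>\<infinity>x\<in>V. h i x)" if "i \<in> I" for i
      using infsum_reindex_bij_betw[OF bij[OF that]] by blast
    define n where "n = real (card I)"
    have pt: "(cmod (markov_operator E f x))\<^sup>2 \<le> K / n\<^sup>2 * (\<Sum>i\<in>I. h i (p i x))"
      if x: "x \<in> V" for x
    proof -
      have "markov_operator E f x = (\<Sum>i\<in>I. f (p i x)) / of_nat (card I)"
        using x by (simp add: markov_operator_def nb sum.reindex[OF inj] card_image[OF inj])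
      then have "cmod (markov_operator E f x) = cmod (\<Sum>i\<in>I. f (p i x)) / n"
        by (simp add: norm_divide n_def)
      also have "\<dots> \<le> (\<Sum>i\<in>I. cmod (f (p i x))) / n"
        by (intro divide_right_mono norm_sum) (simp add: n_def)
      finally have "(cmod (markov_operator E f x))\<^sup>2 \<le> ((\<Sum>i\<in>I. cmod (f (p i x))) / n)\<^sup>2"
        by (intro power_mono) auto
      also have "\<dots> = (\<Sum>i\<in>I. cmod (f (p i x)))\<^sup>2 / n\<^sup>2"
        by (simp add: power_divide)
      also have "\<dots> \<le> (\<Sum>i\<in>I. w x i) * (\<Sum>i\<in>I. (cmod (f (p i x)))\<^sup>2 / w x i) / n\<^sup>2"
        using wpos[OF x] by (intro divide_right_mono weighted_sum_square_le) auto
      also have "(\<Sum>i\<in>I. (cmod (f (p i x)))\<^sup>2 / w x i) = (\<Sum>i\<in>I. h i (p i x))"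
      proof (rule sum.cong[OF HOL.refl])
        fix i assume i: "i \<in> I"
        have "w (p i x) (\<nu> i) = 1 / w x i"
          using wrec[OF x i] wpos[OF x i] by (simp add: field_simps)
        then show "(cmod (f (p i x)))\<^sup>2 / w x i = h i (p i x)"
          by (simp add: h_def F_def)
      qed
      also have "(\<Sum>i\<in>I. w x i) * (\<Sum>i\<in>I. h i (p i x)) / n\<^sup>2
          \<le> K * (\<Sum>i\<in>I. h i (p i x)) / n\<^sup>2"
      proof -
        have "0 \<le> (\<Sum>i\<in>I. h i (p i x))"
          using wpos[OF p[OF _ x] nu(1), THEN less_imp_le] F0
          by (intro sum_nonneg) (auto simp: h_def)
        then show ?thesis using wsum[OF x] by (intro divide_right_mono mult_right_mono) auto
      qed
      finally show ?thesis by simp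
    qed
    have sp: "(\<lambda>x. K / n\<^sup>2 * (\<Sum>i\<in>I. h i (p i x))) summable_on V"
      using hps fin by (intro summable_on_cmult_right summable_on_sum) auto
    then have sM: "(\<lambda>x. (cmod (markov_operator E f x))\<^sup>2) summable_on V"
      by (rule summable_on_comparison_test) (use pt in auto)
    have "(\<Sum>\<^sub>\<infinity>x\<in>V. (cmod (markov_operator E f x))\<^sup>2)
        \<le> (\<Sum>\<^sub>\<infinity>x\<in>V. K / n\<^sup>2 * (\<Sum>i\<in>I. h i (p i x)))"
      using pt by (intro infsum_mono sM sp)
    also have "\<dots> = K / n\<^sup>2 * (\<Sum>i\<in>I. \<Sum>\<^sub>\<infinity>x\<in>V. h i (p i x))"
      using hps fin by (subst infsum_cmult_right) (auto simp: infsum_sum intro!: summable_on_sum)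
    also have "(\<Sum>i\<in>I. \<Sum>\<^sub>\<infinity>x\<in>V. h i (p i x)) = (\<Sum>\<^sub>\<infinity>x\<in>V. \<Sum>i\<in>I. h i x)"
      using hs fin by (simp add: hpi infsum_sum)
    also have "K / n\<^sup>2 * \<dots> \<le> K / n\<^sup>2 * (\<Sum>\<^sub>\<infinity>x\<in>V. K * F x)"
    proof (intro mult_left_mono infsum_mono FK)
      show "(\<lambda>x. \<Sum>i\<in>I. h i x) summable_on V"
        using hs fin by (intro summable_on_sum) auto
      fix x assume x: "x \<in> V"
      have "(\<Sum>i\<in>I. w x (\<nu> i)) = (\<Sum>i\<in>I. w x i)"
        using nu by (intro sum.reindex_bij_witness[of _ \<nu> \<nu>]) auto
      then show "(\<Sum>i\<in>I. h i x) \<le> K * F x"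
        using wsum[OF x] F0[of x]
        by (simp add: h_def flip: sum_distrib_left) (metis mult.commute mult_left_mono)
    qed (use K in auto)
    also have "\<dots> = (K / n)\<^sup>2 * infsum F V"
      using F by (simp add: infsum_cmult_right power2_eq_square)
    also have "\<dots> \<le> (K / n)\<^sup>2 * 1"
      using f(2) by (intro mult_left_mono) (auto simp: ell2_norm_def F_def[abs_def])
    finally show ?thesis
      using K unfolding ell2_norm_def n_def by (intro real_le_lsqrt) auto
  qed
  \<comment> \<open>Bounding a real supremum from above requires a nonempty set.\<close>
  have "(\<lambda>_. 0) \<in> {f \<in> ell2 V. ell2_norm V f \<le> 1}"
    by (simp add: ell2_def ell2_norm_def)
  then show ?thesis
    unfolding spectral_radius_def ell2_opnorm_def
    using bound by (intro cSUP_least) auto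
qed

section \<open>Free reduction\<close>

definition flip :: "'a \<times> bool \<Rightarrow> 'a \<times> bool" where
  "flip x = (fst x, \<not> snd x)"

definition formal_inv :: "'a word \<Rightarrow> 'a word" where
  "formal_inv u = rev (map flip u)"

definition reduced :: "'a word \<Rightarrow> bool" where
  "reduced = successively (\<lambda>x y. y \<noteq> flip x)"

text \<open>A reduced word stands for an element of the free group, and \<open>ins x\<close> is multiplication by
  the letter \<open>x\<close>; the head of the list is the letter multiplied last, so words act by \<open>fold ins\<close>.\<close>

definition ins :: "'a \<times> bool \<Rightarrow> 'a word \<Rightarrow> 'a word" where
  "ins x w = (if w \<noteq> [] \<and> hd w = flip x then tl w else x # w)"

lemma flip_flip [simp]: "flip (flip x) = x"
  by (simp add: flip_def)

lemma fst_flip [simp]: "fst (flip x) = fst x"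
  by (simp add: flip_def)

lemma snd_flip [simp]: "snd (flip x) = (\<not> snd x)"
  by (simp add: flip_def)

lemma flip_eq_iff: "flip x = y \<longleftrightarrow> x = flip y"
  by (auto simp: flip_def)

lemma flip_neq [simp]: "flip x \<noteq> x" "x \<noteq> flip x"
  by (auto simp: flip_def prod_eq_iff)

lemma formal_inv_formal_inv [simp]: "formal_inv (formal_inv u) = u"
  by (simp add: formal_inv_def rev_map comp_def)

lemma fst_set_formal_inv [simp]: "fst ` set (formal_inv u) = fst ` set u"
  by (simp add: formal_inv_def image_image)

lemma reduced_Nil [simp]: "reduced []"
  by (simp add: reduced_def)

lemma reduced_Cons: "reduced (x # w) \<longleftrightarrow> reduced w \<and> (w \<noteq> [] \<longrightarrow> hd w \<noteq> flip x)"
  by (cases w) (auto simp: reduced_def)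

lemma reduced_ins: "reduced w \<Longrightarrow> reduced (ins x w)"
  by (cases w) (auto simp: ins_def reduced_Cons)

text \<open>Reducedness matters: on \<open>flip x # x # v\<close> both insertions would cancel,
  leaving \<open>v\<close>.\<close>

lemma ins_flip_ins: "reduced w \<Longrightarrow> ins (flip x) (ins x w) = w"
  by (cases w) (auto simp: ins_def reduced_Cons)

lemma reduced_fold_ins: "reduced w \<Longrightarrow> reduced (fold ins u w)"
  by (induction u arbitrary: w) (auto simp: reduced_ins)

lemma fold_ins_formal_inv: "reduced w \<Longrightarrow> fold ins (formal_inv u) (fold ins u w) = w"
  by (induction u arbitrary: w) (auto simp: formal_inv_def reduced_ins ins_flip_ins)

lemma fold_ins_formal_inv': "reduced w \<Longrightarrow> fold ins u (fold ins (formal_inv u) w) = w"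
  using fold_ins_formal_inv[of w "formal_inv u"] by simp

section \<open>Transvections of a free group\<close>

text \<open>Image of a letter under the transvection of the free group that takes the generator
  \<open>c\<close> to \<open>V\<inverse> c\<close> and fixes the other generators.\<close>

definition transv_letter :: "'a \<Rightarrow> 'a word \<Rightarrow> 'a \<times> bool \<Rightarrow> 'a word" where
  "transv_letter c V x =
    (if fst x \<noteq> c then [x] else if snd x then formal_inv V @ [x] else x # V)"

text \<open>\<open>foldr\<close> starts at the end of the list, where the letter multiplied first is
  stored; the images of letters are in reading order and act by \<open>fold\<close>.\<close>

definition transv :: "'a \<Rightarrow> 'a word \<Rightarrow> 'a word \<Rightarrow> 'a word" where
  "transv c V w = foldr (\<lambda>x. fold ins (transv_letter c V x)) w []"

lemma transv_Nil [simp]: "transv c V [] = []"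
  by (simp add: transv_def)

lemma transv_Cons: "transv c V (x # w) = fold ins (transv_letter c V x) (transv c V w)"
  by (simp add: transv_def)

lemma reduced_transv: "reduced (transv c V w)"
  by (induction w) (auto simp: transv_Cons reduced_fold_ins)

lemma fold_ins_transv_letter_flip:
  assumes "reduced w"
  shows "fold ins (transv_letter c V (flip x)) (fold ins (transv_letter c V x) w) = w"
  using assms ins_flip_ins[of w x] ins_flip_ins[of "fold ins (formal_inv V) w" x]
    fold_ins_formal_inv'[of w V] fold_ins_formal_inv[of "ins x w" V]
  by (auto simp: transv_letter_def reduced_fold_ins reduced_ins)

text \<open>Multiplicativity, one letter at a time: where \<open>ins x\<close> cancels, the images
  of \<open>x\<close> and \<open>flip x\<close>, being mutually inverse, cancel too.\<close>

lemma transv_ins: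
  assumes "reduced w"
  shows "transv c V (ins x w) = fold ins (transv_letter c V x) (transv c V w)"
proof (cases "w \<noteq> [] \<and> hd w = flip x")
  case True
  then obtain v where w: "w = flip x # v" by (cases w) auto
  show ?thesis
    using fold_ins_transv_letter_flip[OF reduced_transv, of c V "flip x" c V v]
    by (simp add: w ins_def transv_Cons)
next
  case False
  then show ?thesis by (auto simp: ins_def transv_Cons)
qed

lemma transv_fold_ins:
  assumes "reduced w" "c \<notin> fst ` set u"
  shows "transv c V (fold ins u w) = fold ins u (transv c V w)"
  using assms
  by (induction u arbitrary: w) (auto simp: transv_ins reduced_ins transv_letter_def)

text \<open>As \<open>V\<close> avoids \<open>c\<close>, both transvections fix it, so
  \<open>c\<close> goes to V^-1 c and then to V^-1 V c = c.\<close>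

lemma transv_formal_inv:
  assumes "reduced w" "c \<notin> fst ` set V"
  shows "transv c (formal_inv V) (transv c V w) = w"
  using assms(1)
proof (induction w)
  case (Cons x w)
  then have w: "reduced w" and IH: "transv c (formal_inv V) (transv c V w) = w"
    and x: "ins x w = x # w"
    by (auto simp: reduced_Cons ins_def)
  have c: "c \<notin> fst ` set (formal_inv V)" using assms(2) by simp
  show ?case
    using IH w x fold_ins_formal_inv[OF w, of V] fold_ins_formal_inv'[OF w, of V]
      fold_ins_formal_inv[OF reduced_ins[OF w], of V x]
      fold_ins_formal_inv'[OF reduced_ins[OF w], of V x]
    by (cases "fst x = c") (simp_all add: transv_Cons transv_letter_def transv_ins reduced_transv
        reduced_ins reduced_fold_ins transv_fold_ins[OF _ assms(2)] transv_fold_ins[OF _ c])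
qed simp

section \<open>The action of a one-relator group\<close>

definition act_letter :: "'a \<Rightarrow> 'a \<Rightarrow> 'a word \<Rightarrow> 'a \<times> bool \<Rightarrow> 'a word \<Rightarrow> 'a word" where
  "act_letter c d V s =
    (if fst s \<noteq> d then ins s else if snd s then transv c V else transv c (formal_inv V))"

lemma reduced_act_letter: "reduced w \<Longrightarrow> reduced (act_letter c d V s w)"
  by (simp add: act_letter_def reduced_ins reduced_transv)

lemma reduced_fold_act_letter: "reduced w \<Longrightarrow> reduced (fold (act_letter c d V) u w)"
  by (induction u arbitrary: w) (auto simp: reduced_act_letter)

lemma act_letter_flip:
  assumes "reduced w" "c \<notin> fst ` set V"
  shows "act_letter c d V (flip s) (act_letter c d V s w) = w"
  using assms transv_formal_inv[of w c V] transv_formal_inv[of w c "formal_inv V"]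
  by (auto simp: act_letter_def ins_flip_ins)

lemma fold_act_letter_eq_fold_ins:
  assumes "d \<notin> fst ` set u"
  shows "fold (act_letter c d V) u w = fold ins u w"
  using assms by (induction u arbitrary: w) (auto simp: act_letter_def)

definition commutator_word :: "'a \<Rightarrow> 'a \<Rightarrow> 'a word" where
  "commutator_word c d = [(c, True), (d, True), (c, False), (d, False)]"

text \<open>With t the transvection, \<open>w\<close> passes through w V, w V c, t(w) V V^-1 c =
  t(w) c, t(w) and back to \<open>w\<close>. \<open>V\<close> acts by multiplication as it avoids
  \<open>d\<close>, and t fixes it as it avoids \<open>c\<close>.\<close>

lemma fold_act_letter_relator:
  assumes "reduced w" "c \<notin> fst ` set V" "d \<notin> fst ` set V" "c \<noteq> d"
  shows "fold (act_letter c d V) (V @ commutator_word c d) w = w"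
proof -
  let ?v = "fold ins V w"
  have "transv c V (ins (c, True) ?v) = ins (c, True) (transv c V w)"
    using assms
    by (simp add: transv_ins reduced_fold_ins transv_fold_ins transv_letter_def
        fold_ins_formal_inv reduced_transv)
  then show ?thesis
    using assms ins_flip_ins[OF reduced_transv, of "(c, True)" c V w]
      transv_formal_inv[of w c V]
    by (simp add: commutator_word_def fold_act_letter_eq_fold_ins)
       (simp add: act_letter_def flip_def)
qed

text \<open>This lets the presented group itself act on reduced words.\<close>

lemma pres_eq_fold_act_letter:
  assumes "pres_eq A {V @ commutator_word c d} u v" "reduced w"
    and "c \<notin> fst ` set V" "d \<notin> fst ` set V" "c \<noteq> d"
  shows "fold (act_letter c d V) u w = fold (act_letter c d V) v w"
  using assms
proof (induction arbitrary: w)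
  case (cancel u v a e)
  then show ?case
    using act_letter_flip[OF reduced_fold_act_letter[of w c d V u], of c V d "(a, e)"]
    by (simp add: flip_def)
next
  case (relator u v r)
  then show ?case
    using fold_act_letter_relator[OF reduced_fold_act_letter[of w c d V u], of c V d]
    by simp
qed auto

section \<open>Exponent sums: separating letters in the abelianisation\<close>

definition exponent_sum :: "'a \<Rightarrow> 'a word \<Rightarrow> int" where
  "exponent_sum a u = sum_list (map (\<lambda>x. if fst x = a then if snd x then 1 else -1 else 0) u)"

lemma exponent_sum_simps [simp]:
  "exponent_sum a [] = 0"
  "exponent_sum a (x # u) =
    (if fst x = a then if snd x then 1 else -1 else 0) + exponent_sum a u"
  "exponent_sum a (u @ v) = exponent_sum a u + exponent_sum a v"
  by (simp_all add: exponent_sum_def)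

lemma pres_eq_exponent_sum:
  assumes "pres_eq A R u v" "\<And>r. r \<in> R \<Longrightarrow> exponent_sum a r = 0"
  shows "exponent_sum a u = exponent_sum a v"
  using assms by induction auto

text \<open>Serves to show that distinct labels lead to distinct neighbours in the Cayley
  graph.\<close>

lemma exponent_sum_letter_inj:
  assumes "\<And>a. exponent_sum a [x] = exponent_sum a [y]"
  shows "x = y"
  using assms[of "fst x"] assms[of "fst y"] by (auto simp: prod_eq_iff split: if_splits)

section \<open>Cayley graphs of presented groups\<close>

definition letter_class :: "'a set \<Rightarrow> 'a word set \<Rightarrow> 'a \<times> bool \<Rightarrow> 'a word set" where
  "letter_class A R x = pres_rel A R `` {[x]}"

definition pres_genset :: "'a set \<Rightarrow> 'a word set \<Rightarrow> 'a word set set" where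
  "pres_genset A R = letter_class A R ` (A \<times> UNIV)"

lemma letter_class_carrier: "fst x \<in> A \<Longrightarrow> letter_class A R x \<in> carrier (presented_group A R)"
  by (auto simp: letter_class_def)

lemma letter_class_flip:
  assumes "fst x \<in> A"
  shows "letter_class A R x \<otimes>\<^bsub>presented_group A R\<^esub> letter_class A R (flip x)
    = \<one>\<^bsub>presented_group A R\<^esub>"
proof -
  have "pres_eq A R ([] @ [(fst x, snd x), (fst x, \<not> snd x)] @ []) ([] @ [])"
    using assms by (intro pres_eq.cancel) auto
  then have "pres_rel A R `` {[x] @ [flip x]} = pres_rel A R `` {[]}"
    by (intro equiv_class_eq[OF equiv_pres_rel]) (simp add: pres_rel_def flip_def)
  moreover have "\<one>\<^bsub>presented_group A R\<^esub> = pres_rel A R `` {[]}"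
    by (simp add: presented_group_def)
  ultimately show ?thesis
    using assms unfolding letter_class_def by (subst presented_group_mult) auto
qed

lemma inv_letter_class:
  assumes "fst x \<in> A"
  shows "inv\<^bsub>presented_group A R\<^esub> (letter_class A R x) = letter_class A R (flip x)"
  using assms letter_class_flip[of "flip x" A R]
  by (intro group.inv_equality[OF group_presented_group]) (auto intro: letter_class_carrier)

lemma (in group) neighbours_cayley_edges:
  assumes "x \<in> carrier G" "S \<subseteq> carrier G" "\<And>s. s \<in> S \<Longrightarrow> inv s \<in> S"
  shows "neighbours (cayley_edges G S) x = (\<lambda>s. x \<otimes> s) ` S"
proof (intro equalityI subsetI)
  fix y assume "y \<in> neighbours (cayley_edges G S) x"
  then obtain u v where uv: "{x, y} = {u, v}" "u \<in> carrier G" "v \<in> carrier G" "inv u \<otimes> v \<in> S"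
    by (auto simp: neighbours_def cayley_edges_def)
  \<comment> \<open>Edges are unordered, so \<open>x\<close> may be \<open>v\<close>; the label read
    from \<open>x\<close> is then this inverse, again in \<open>S\<close> by symmetry.\<close>
  have "inv (inv u \<otimes> v) = inv v \<otimes> u"
    using uv by (simp add: inv_mult_group)
  then have "y \<in> carrier G \<and> inv x \<otimes> y \<in> S"
    using uv assms(3)[OF uv(4)] by (auto simp: doubleton_eq_iff)
  moreover from this have "y = x \<otimes> (inv x \<otimes> y)"
    using assms(1) by (simp flip: m_assoc)
  ultimately show "y \<in> (\<lambda>s. x \<otimes> s) ` S" by blast
next
  fix y assume "y \<in> (\<lambda>s. x \<otimes> s) ` S"
  then obtain s where s: "s \<in> S" "y = x \<otimes> s" by blast
  then have "y \<in> carrier G" "inv x \<otimes> y = s"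
    using assms by (auto simp flip: m_assoc)
  then show "y \<in> neighbours (cayley_edges G S) x"
    using s assms(1) unfolding neighbours_def cayley_edges_def by blast
qed

text \<open>That \<open>V\<close> avoids \<open>c\<close> and \<open>d\<close> yields the action;
  the vanishing exponent sums keep the \<open>2 * card A\<close> neighbours of a vertex
  distinct.\<close>

theorem spectral_radius_one_relator_le:
  assumes fin: "finite A" and cd: "c \<in> A" "d \<in> A" "c \<noteq> d"
    and V: "V \<in> words (A - {c, d})"
    and ex: "\<And>a. exponent_sum a V = 0"
  defines "R \<equiv> {V @ commutator_word c d}"
  shows "spectral_radius (carrier (presented_group A R))
      (cayley_edges (presented_group A R) (pres_genset A R))
    \<le> 2 * sqrt (real (card A) - 1) / card A"
proof -
  let ?G = "presented_group A R"
  interpret group ?G by (rule group_presented_group)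
  have Vc: "c \<notin> fst ` set V" and Vd: "d \<notin> fst ` set V"
    using V by (auto simp: words_def)
  define I where "I = A \<times> (UNIV :: bool set)"
  have finI: "finite I" using fin by (simp add: I_def)
  have cardI: "card I = 2 * card A" by (simp add: I_def card_cartesian_product)
  have "card {c, d} \<le> card A"
    using cd fin by (intro card_mono) auto
  then have card2: "card A \<ge> 2" using cd by simp
  \<comment> \<open>This value minimises the weight bound
    \<open>2 * q + (2 * card A - 2) / q\<close> by making its terms equal.\<close>
  define q where "q = sqrt (real (card A) - 1)"
  have q: "q \<ge> 1" "q\<^sup>2 = real (card A) - 1"
    using card2 by (auto simp: q_def)
  \<comment> \<open>The image of the trivial free group element under \<open>X\<close>; the choice
    of word is immaterial because equivalent words act alike.\<close>
  define red where "red X =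
    fold (act_letter c d V) (SOME u. u \<in> words A \<and> X = pres_rel A R `` {u}) []" for X
  have red_class: "red (pres_rel A R `` {u}) = fold (act_letter c d V) u []"
    if u: "u \<in> words A" for u
  proof -
    define v where "v = (SOME v. v \<in> words A \<and> pres_rel A R `` {u} = pres_rel A R `` {v})"
    have v: "v \<in> words A" "pres_rel A R `` {u} = pres_rel A R `` {v}"
      using someI[of "\<lambda>v. v \<in> words A \<and> pres_rel A R `` {u} = pres_rel A R `` {v}" u] u
      by (auto simp: v_def)
    then have "pres_eq A R v u"
      using eq_equiv_class[OF v(2) equiv_pres_rel] by (auto simp: pres_rel_def intro: pres_eq.sym)
    then show ?thesis
      using pres_eq_fold_act_letter[of A V c d v u "[]"] Vc Vd cd
      by (simp add: red_def v_def R_def)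
  qed
  have reduced_red: "reduced (red X)" for X
    by (simp add: red_def reduced_fold_act_letter)
  define p where "p s X = X \<otimes>\<^bsub>?G\<^esub> letter_class A R s" for s X
  have red_p: "red (p s X) = act_letter c d V s (red X)"
    if X: "X \<in> carrier ?G" and s: "s \<in> I" for s X
  proof -
    obtain u where u: "u \<in> words A" "X = pres_rel A R `` {u}"
      using X by (rule presented_group_cases)
    then show ?thesis
      using s by (simp add: p_def letter_class_def presented_group_mult red_class I_def
          mem_Times_iff)
  qed
  define forward where "forward X s \<longleftrightarrow>
    (if fst s = d then snd s else red X \<noteq> [] \<and> hd (red X) = flip s)" for X s
  define w where "w X s = (if forward X s then q else 1 / q)" for X s
  \<comment> \<open>After \<open>flip s\<close> is cancelled from a reduced word, the new head is
    not \<open>s\<close>, so the reverse edge does not shorten again; after \<open>s\<close> is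
    prepended, it does.\<close>
  have forward_p: "forward (p s X) (flip s) \<longleftrightarrow> \<not> forward X s"
    if X: "X \<in> carrier ?G" and s: "s \<in> I" for s X
    using reduced_red[of X] red_p[OF X s]
    by (cases "red X") (auto simp: forward_def act_letter_def ins_def reduced_Cons)
  have "spectral_radius (carrier ?G) (cayley_edges ?G (pres_genset A R)) \<le> 4 * q / card I"
  proof (rule spectral_radius_le_weights[where I = I and p = p and \<nu> = flip and w = w])
    show "finite I" by (rule finI)
    show "flip i \<in> I" "flip (flip i) = i" if "i \<in> I" for i
      using that by (auto simp: I_def mem_Times_iff)
    show "p i x \<in> carrier ?G" if "i \<in> I" "x \<in> carrier ?G" for i x
      using that by (auto simp: p_def I_def intro!: letter_class_carrier)
    show "p (flip i) (p i x) = x" if "i \<in> I" "x \<in> carrier ?G" for i x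
      using that letter_class_carrier[of i A R] letter_class_carrier[of "flip i" A R]
        letter_class_flip[of i A R]
      by (auto simp: p_def I_def m_assoc mem_Times_iff)
    show "neighbours (cayley_edges ?G (pres_genset A R)) x = (\<lambda>i. p i x) ` I"
      if "x \<in> carrier ?G" for x
    proof -
      have "inv\<^bsub>?G\<^esub> s \<in> pres_genset A R" if "s \<in> pres_genset A R" for s
        using that by (auto simp: pres_genset_def inv_letter_class mem_Times_iff intro!: imageI)
      then have "neighbours (cayley_edges ?G (pres_genset A R)) x
          = (\<lambda>s. x \<otimes>\<^bsub>?G\<^esub> s) ` pres_genset A R"
        using that by (intro neighbours_cayley_edges)
          (auto simp: pres_genset_def intro!: letter_class_carrier)
      then show ?thesis by (simp add: p_def pres_genset_def I_def image_image)
    qed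
    show "inj_on (\<lambda>i. p i x) I" if x: "x \<in> carrier ?G" for x
    proof (rule inj_onI)
      fix i j assume ij: "i \<in> I" "j \<in> I" "p i x = p j x"
      have "letter_class A R i = letter_class A R j"
        using ij x letter_class_carrier[of i A R] letter_class_carrier[of j A R]
        by (auto simp: p_def I_def mem_Times_iff)
      then have "pres_eq A R [i] [j]"
        using eq_equiv_class[OF _ equiv_pres_rel, of A R "[i]" "[j]"] ij
        by (auto simp: letter_class_def pres_rel_def I_def mem_Times_iff)
      moreover have "exponent_sum a r = 0" if "r \<in> R" for a r
        using that ex by (simp add: R_def commutator_word_def)
      ultimately show "i = j"
        by (intro exponent_sum_letter_inj pres_eq_exponent_sum)
    qed
    show "w x i > 0" for x i using q by (simp add: w_def)
    show "w x i * w (p i x) (flip i) = 1" if "x \<in> carrier ?G" "i \<in> I" for x i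
      using q forward_p[OF that] by (auto simp: w_def)
    show "(\<Sum>i\<in>I. w x i) \<le> 4 * q" for x
    proof -
      define B where "B = {s \<in> I. forward x s}"
      \<comment> \<open>If \<open>red x\<close> is empty, \<open>hd\<close> is an unspecified
        letter, but then only \<open>(d, True)\<close> can be forward and the inclusion still
        holds.\<close>
      have "B \<subseteq> {(d, True), flip (hd (red x))}"
        by (auto simp: B_def forward_def flip_eq_iff split: if_splits)
      then have "card B \<le> card {(d, True), flip (hd (red x))}"
        by (rule card_mono[rotated]) simp
      also have "\<dots> \<le> 2" by (simp add: card_insert_if)
      finally have B: "card B \<le> 2" .
      have "(\<Sum>i\<in>I. w x i) = (\<Sum>i\<in>I. 1 / q + (if i \<in> B then q - 1 / q else 0))"
        by (intro sum.cong) (auto simp: w_def B_def)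
      also have "\<dots> = card I / q + card B * (q - 1 / q)"
        using finI by (simp add: sum.distrib sum.If_cases B_def Int_def)
      \<comment> \<open>As \<open>q \<ge> 1\<close>, the factor \<open>q - 1 / q\<close> is
        nonnegative, so \<open>card B\<close> may be raised to 2.\<close>
      also have "\<dots> \<le> card I / q + 2 * (q - 1 / q)"
        using B q mult_mono[of 1 q 1 q] by (intro add_left_mono mult_right_mono) (auto simp: field_simps)
      also have "\<dots> = 4 * q"
        using q by (simp add: cardI field_simps power2_eq_square)
      finally show ?thesis .
    qed
    show "4 * q \<ge> 0" using q by simp
  qed
  then show ?thesis by (simp add: cardI q_def)
qed

section \<open>Surface groups\<close>

lemma card_surface_gens: "card (surface_gens g) = 2 * g"
proof -
  have "card (surface_gens g) = card (Ga ` {1..g}) + card (Gb ` {1..g})"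
    unfolding surface_gens_def by (intro card_Un_disjoint) auto
  then show ?thesis by (simp add: card_image inj_on_def)
qed

lemma surface_relator_eq:
  "g \<ge> 1 \<Longrightarrow> surface_relator g = surface_relator (g - 1) @ commutator_word (Ga g) (Gb g)"
  by (cases g) (auto simp: surface_relator_def commutator_word_def)

lemma exponent_sum_surface_relator: "exponent_sum a (surface_relator g) = 0"
  by (induction g) (auto simp: surface_relator_def)

lemma surface_relator_words:
  "surface_relator (g - 1) \<in> words (surface_gens g - {Ga g, Gb g})"
  by (cases g) (auto simp: surface_relator_def words_def surface_gens_def)

lemma surface_genset_eq: "surface_genset g = pres_genset (surface_gens g) {surface_relator g}"
proof -
  let ?c = "letter_class (surface_gens g) {surface_relator g}"
  have "inv\<^bsub>surface_group g\<^esub> (?c (x, True)) = ?c (x, False)" if "x \<in> surface_gens g" for x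
    using that by (simp add: surface_group_def inv_letter_class flip_def)
  then have "surface_genset g = (\<Union>x\<in>surface_gens g. {?c (x, True), ?c (x, False)})"
    by (simp add: surface_genset_def pres_gen_def Let_def letter_class_def)
  also have "\<dots> = ?c ` (surface_gens g \<times> UNIV)"
    by (auto simp: UNIV_bool)
  finally show ?thesis by (simp add: pres_genset_def)
qed

text \<open>Splitting off the last commutator leaves as \<open>V\<close> the product of the first g
  - 1 commutators; there are 2g generators.\<close>

lemma surface_mu_le:
  assumes "g \<ge> 1"
  shows "surface_mu g \<le> sqrt (2 * real g - 1) / real g"
proof -
  have "spectral_radius (carrier (presented_group (surface_gens g) {surface_relator g}))
      (cayley_edges (presented_group (surface_gens g) {surface_relator g})
        (pres_genset (surface_gens g) {surface_relator g}))
    \<le> 2 * sqrt (real (card (surface_gens g)) - 1) / card (surface_gens g)"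
    unfolding surface_relator_eq[OF assms]
    using assms exponent_sum_surface_relator surface_relator_words
    by (intro spectral_radius_one_relator_le) (auto simp: surface_gens_def)
  then show ?thesis
    by (simp add: surface_mu_def surface_group_def surface_genset_eq card_surface_gens)
qed

theorem corollary1:
  shows "(\<forall>g::nat. g \<ge> 2 \<longrightarrow> surface_mu g \<le> sqrt (2 * real g - 1) / real g)
    \<and> surface_mu 2 \<le> sqrt 3 / 2
    \<and> \<bar>sqrt 3 / 2 - 0.8660\<bar> < (0.00005 :: real)"
proof (intro conjI allI impI)
  show "surface_mu g \<le> sqrt (2 * real g - 1) / real g" if "g \<ge> 2" for g
    using that by (intro surface_mu_le) simp
  show "surface_mu 2 \<le> sqrt 3 / 2"
    using surface_mu_le[of 2] by simp
  \<comment> \<open>Halving the two bounds gives 0.866 and 0.86605, within the stated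
    tolerance.\<close>
  have "1.732 < sqrt 3"
    by (rule real_less_rsqrt) (simp add: power2_eq_square)
  moreover have "sqrt 3 < 1.7321"
    by (rule real_less_lsqrt) (simp_all add: power2_eq_square)
  ultimately show "\<bar>sqrt 3 / 2 - 0.8660\<bar> < (0.00005 :: real)" by simp
qed

end
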